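(* Let $p,q\in\mathbb{F}[t]$ be monic polynomials of degree $2$ and set $\delta:=\operatorname{tr}p-\operatorname{tr}q$. Let $r$ be a nonconstant monic polynomial of $\mathbb{F}[t]$. Then there exists a symplectic pair $(b,u)$ over $\mathbb{F}$ such that: (i) $(b,u)$ is a symplectic $(p,q)$-difference; (ii) the endomorphism $u$ has exactly two (nontrivial) invariant factors: $r(t^2-\delta t)$ and $r(t^2-\delta t)$.
   Context: $\mathbb{F}$ is an arbitrary field (characteristic $2$ allowed); all vector spaces are finite-dimensional over $\mathbb{F}$. For a monic polynomial $r\in\mathbb{F}[t]$ of degree $n>0$, $\operatorname{tr}r$ is the opposite of the coefficient of $r$ on $t^{n-1}$. A symplectic form is a non-degenerate alternating bilinear form. Given a symplectic form $b$ on $V$, an endomorphism $u$ of $V$ is $b$-alternating if $b(x,u(x))=0$ for all $x\in V$. A symplectic pair $(b,u)$ consists of a symplectic form $b$ on a vector space and a $b$-alternating endomorphism $u$ of it. It is a symplectic $(p,q)$-difference if there are $b$-alternating endomorphisms $u_1,u_2$ with $u=u_1-u_2$, $p(u_1)=0$ and $q(u_2)=0$. *)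

theory Defs
  imports "Jordan_Normal_Form.VS_Connect"
begin

(* Vector spaces over the field 'a are module records V with
   vectorspace class_ring V; their elements range over carrier V, so maps and
   forms only matter on carrier V. *)

definition endomorphism :: "('a::field, 'v) module \<Rightarrow> ('v \<Rightarrow> 'v) \<Rightarrow> bool" where
  "endomorphism V u \<longleftrightarrow> linear_map class_ring V V u"

(* poly_end V f u is the map f(u). *)
definition poly_end :: "('a::field, 'v) module \<Rightarrow> 'a poly \<Rightarrow> ('v \<Rightarrow> 'v) \<Rightarrow> 'v \<Rightarrow> 'v" where
  "poly_end V f u x = (\<Oplus>\<^bsub>V\<^esub>i\<in>{..degree f}. coeff f i \<odot>\<^bsub>V\<^esub> (u ^^ i) x)"

definition bilinear_form :: "('a::field, 'v) module \<Rightarrow> ('v \<Rightarrow> 'v \<Rightarrow> 'a) \<Rightarrow> bool" where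
  "bilinear_form V b \<longleftrightarrow>
     (\<forall>x\<in>carrier V. \<forall>y\<in>carrier V. \<forall>z\<in>carrier V.
        b (x \<oplus>\<^bsub>V\<^esub> y) z = b x z + b y z \<and> b z (x \<oplus>\<^bsub>V\<^esub> y) = b z x + b z y) \<and>
     (\<forall>c. \<forall>x\<in>carrier V. \<forall>y\<in>carrier V.
        b (c \<odot>\<^bsub>V\<^esub> x) y = c * b x y \<and> b x (c \<odot>\<^bsub>V\<^esub> y) = c * b x y)"

definition symplectic_form :: "('a::field, 'v) module \<Rightarrow> ('v \<Rightarrow> 'v \<Rightarrow> 'a) \<Rightarrow> bool" where
  "symplectic_form V b \<longleftrightarrow>
     bilinear_form V b \<and>
     (\<forall>x\<in>carrier V. b x x = 0) \<and>
     (\<forall>x\<in>carrier V. (\<forall>y\<in>carrier V. b x y = 0) \<longrightarrow> x = \<zero>\<^bsub>V\<^esub>)"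

definition alternating_end :: "('a::field, 'v) module \<Rightarrow> ('v \<Rightarrow> 'v \<Rightarrow> 'a) \<Rightarrow> ('v \<Rightarrow> 'v) \<Rightarrow> bool" where
  "alternating_end V b u \<longleftrightarrow> endomorphism V u \<and> (\<forall>x\<in>carrier V. b x (u x) = 0)"

definition symplectic_pair :: "('a::field, 'v) module \<Rightarrow> ('v \<Rightarrow> 'v \<Rightarrow> 'a) \<Rightarrow> ('v \<Rightarrow> 'v) \<Rightarrow> bool" where
  "symplectic_pair V b u \<longleftrightarrow>
     vectorspace class_ring V \<and> vectorspace.fin_dim class_ring V \<and>
     symplectic_form V b \<and> alternating_end V b u"

definition symplectic_difference ::
  "'a::field poly \<Rightarrow> 'a poly \<Rightarrow> ('a, 'v) module \<Rightarrow> ('v \<Rightarrow> 'v \<Rightarrow> 'a) \<Rightarrow> ('v \<Rightarrow> 'v) \<Rightarrow> bool" where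
  "symplectic_difference p q V b u \<longleftrightarrow>
     symplectic_pair V b u \<and>
     (\<exists>u1 u2. alternating_end V b u1 \<and> alternating_end V b u2 \<and>
        (\<forall>x\<in>carrier V. u x = u1 x \<ominus>\<^bsub>V\<^esub> u2 x) \<and>
        (\<forall>x\<in>carrier V. poly_end V p u1 x = \<zero>\<^bsub>V\<^esub>) \<and>
        (\<forall>x\<in>carrier V. poly_end V q u2 x = \<zero>\<^bsub>V\<^esub>))"

(* poly_trace r is meant for monic r of positive degree. *)
definition poly_trace :: "'a::field poly \<Rightarrow> 'a" where
  "poly_trace r = - coeff r (degree r - 1)"

(* The list rs consists of all nontrivial invariant factors of u, each dividing
   the preceding one: V, with t acting as u, is the F[t]-module
   F[t]/(rs!0) + ... + F[t]/(rs!(k-1)) (direct sum), where e i generates the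
   i-th summand. The two conditions on e say that
   (f 0, ..., f (k-1)) |-> f_0(u)(e 0) + ... + f_(k-1)(u)(e (k-1))
   maps F[t]^k onto V with kernel (rs!0) x ... x (rs!(k-1)). *)
definition invariant_factors :: "('a::field, 'v) module \<Rightarrow> ('v \<Rightarrow> 'v) \<Rightarrow> 'a poly list \<Rightarrow> bool" where
  "invariant_factors V u rs \<longleftrightarrow>
     (\<forall>r\<in>set rs. lead_coeff r = 1 \<and> degree r > 0) \<and>
     sorted_wrt (\<lambda>r s. s dvd r) rs \<and>
     (\<exists>e. (\<forall>i<length rs. e i \<in> carrier V) \<and>
        (\<forall>v\<in>carrier V. \<exists>f :: nat \<Rightarrow> 'a poly.
           v = (\<Oplus>\<^bsub>V\<^esub>i\<in>{..<length rs}. poly_end V (f i) u (e i))) \<and>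
        (\<forall>f :: nat \<Rightarrow> 'a poly.
           (\<Oplus>\<^bsub>V\<^esub>i\<in>{..<length rs}. poly_end V (f i) u (e i)) = \<zero>\<^bsub>V\<^esub> \<longleftrightarrow>
           (\<forall>i<length rs. rs ! i dvd f i)))"

end

(* In the algebra generated by two elements a, b subject to p(a) = 0 and q(b) = 0, put u = a - b.
   Then z = u^2 - delta u is central, and the algebra is free over F[z] with basis 1, u, a, u a.
   It is free over F[u] with basis 1, a, so left multiplication by u on its quotient by r(z) has
   the invariant factors r(t^2 - delta t), twice. The algebra has an anti-involution x |-> x^*
   fixing a and b. For (x, y) |-> phi(x^* y), where phi is the coefficient on u a, left
   multiplications by a and b are therefore self-adjoint, and in fact alternating, also in
   characteristic 2. Composing this form over F[z]/(r) with a linear functional on F[z]/(r) whose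
   kernel contains no nonzero ideal gives the symplectic form over F. *)
theory Submission
  imports Defs
begin

section \<open>Polynomial coordinates on vectors\<close>

text \<open>The vector \<open>pack r P0 P1 P2 P3\<close> represents the class of the quadruple in
  \<open>(F[z]/(r))\<^sup>4\<close>; the \<open>i\<close>-th block of length \<open>degree r\<close> lists the coefficients of
  \<open>P\<^sub>i mod r\<close>.\<close>

definition pack :: "'a::field poly \<Rightarrow> 'a poly \<Rightarrow> 'a poly \<Rightarrow> 'a poly \<Rightarrow> 'a poly \<Rightarrow> 'a vec" where
  "pack r P0 P1 P2 P3 = vec (4 * degree r)
     (\<lambda>k. coeff (([P0, P1, P2, P3] ! (k div degree r)) mod r) (k mod degree r))"

definition blk :: "'a::field poly \<Rightarrow> 'a vec \<Rightarrow> nat \<Rightarrow> 'a poly" where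
  "blk r x i = (\<Sum>j<degree r. monom (x $ (i * degree r + j)) j)"

lemma pack_carrier [simp]: "pack r P0 P1 P2 P3 \<in> carrier_vec (4 * degree r)"
  by (simp add: pack_def)

lemma dim_pack [simp]: "dim_vec (pack r P0 P1 P2 P3) = 4 * degree r"
  by (simp add: pack_def)

lemma coeff_blk: "coeff (blk r x i) j = (if j < degree r then x $ (i * degree r + j) else 0)"
  by (auto simp: blk_def coeff_sum if_distrib[of "\<lambda>a. a = _"] cong: if_cong)

lemma block_index: "i < 4 \<Longrightarrow> j < d \<Longrightarrow> i * d + j < 4 * (d::nat)"
proof -
  assume "i < 4" "j < d"
  then have "i * d + j < (i + 1) * d" by simp
  also have "\<dots> \<le> 4 * d" using \<open>i < 4\<close> by (intro mult_right_mono) auto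
  finally show ?thesis .
qed

lemma blk_pack:
  assumes "degree r > 0" "i < 4"
  shows "blk r (pack r P0 P1 P2 P3) i = ([P0, P1, P2, P3] ! i) mod r"
proof (rule poly_eqI)
  fix j
  have "degree (P mod r) < degree r" for P
    using assms(1) degree_mod_less[of r P] by (cases "r = 0") auto
  then have "coeff (P mod r) j = 0" if "\<not> j < degree r" for P
    using that by (meson coeff_eq_0 not_less order_less_le_trans)
  then show "coeff (blk r (pack r P0 P1 P2 P3) i) j = coeff (([P0, P1, P2, P3] ! i) mod r) j"
    using assms block_index[of i j "degree r"] by (auto simp: coeff_blk pack_def)
qed

lemma blk_pack_simps:
  assumes "degree r > 0"
  shows "blk r (pack r P0 P1 P2 P3) 0 = P0 mod r" "blk r (pack r P0 P1 P2 P3) 1 = P1 mod r"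
    "blk r (pack r P0 P1 P2 P3) 2 = P2 mod r" "blk r (pack r P0 P1 P2 P3) 3 = P3 mod r"
  using blk_pack[OF assms] by simp_all

text \<open>The maps and the form are polynomial expressions in the blocks, hence depend on them
  only modulo \<open>r\<close>; these rules strip the inner \<open>mod r\<close> that unpacking
  leaves behind.\<close>

lemmas mod_cong_intros = mod_add_cong mod_diff_cong mod_mult_cong mod_minus_cong mod_mod_trivial refl

lemma pack_blk:
  assumes "x \<in> carrier_vec (4 * degree r)"
  shows "pack r (blk r x 0) (blk r x 1) (blk r x 2) (blk r x 3) = x"
proof (rule eq_vecI)
  fix k assume "k < dim_vec x"
  then have k: "k < 4 * degree r" using assms by auto
  then have d: "degree r > 0" by (cases "degree r") auto
  have kd: "k div degree r < 4"
    using k by (simp add: less_mult_imp_div_less)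
  have "degree (blk r x i) < degree r" for i
    using d by (intro degree_lessI) (auto simp: coeff_blk)
  then have "blk r x i mod r = blk r x i" for i
    by (simp add: mod_poly_less)
  moreover have "[blk r x 0, blk r x 1, blk r x 2, blk r x 3] ! (k div degree r) = blk r x (k div degree r)"
    using kd by (auto simp: less_Suc_eq numeral_eq_Suc)
  ultimately show "pack r (blk r x 0) (blk r x 1) (blk r x 2) (blk r x 3) $ k = x $ k"
    using k d by (simp add: pack_def coeff_blk)
qed (use assms in auto)

text \<open>Trades a vector for four unreduced polynomials, so that claims about the maps and the
  form become identities between polynomials.\<close>

lemma pack_cases:
  assumes "x \<in> carrier_vec (4 * degree r)"
  obtains P0 P1 P2 P3 where "x = pack r P0 P1 P2 P3"
  using pack_blk[OF assms] by metis

lemma quadruple_index: "k < 4 * d \<Longrightarrow> k div d = 0 \<or> k div d = 1 \<or> k div d = 2 \<or> k div d = (3::nat)"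
  using less_mult_imp_div_less[of k 4 d] by auto

lemma pack_add:
  "pack r P0 P1 P2 P3 + pack r Q0 Q1 Q2 Q3 = pack r (P0 + Q0) (P1 + Q1) (P2 + Q2) (P3 + Q3)"
  by (intro eq_vecI) (auto simp: pack_def poly_mod_add_left dest!: quadruple_index)

text \<open>Scalars appear as constant polynomials so that they can be identified with the
  parameters \<open>al\<close>, \<open>l\<close>, \<open>be\<close>, \<open>de\<close> in the root
  lemmas.\<close>

lemma pack_smult:
  "a \<cdot>\<^sub>v pack r P0 P1 P2 P3 = pack r ([:a:] * P0) ([:a:] * P1) ([:a:] * P2) ([:a:] * P3)"
  by (intro eq_vecI) (auto simp: pack_def mod_smult_left dest!: quadruple_index)

lemma pack_diff:
  "pack r P0 P1 P2 P3 - pack r Q0 Q1 Q2 Q3 = pack r (P0 - Q0) (P1 - Q1) (P2 - Q2) (P3 - Q3)"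
  by (intro eq_vecI) (auto simp: pack_def poly_mod_diff_left dest!: quadruple_index)

lemma pack_cong:
  assumes "P0 mod r = Q0 mod r" "P1 mod r = Q1 mod r" "P2 mod r = Q2 mod r" "P3 mod r = Q3 mod r"
  shows "pack r P0 P1 P2 P3 = pack r Q0 Q1 Q2 Q3"
  using assms by (intro eq_vecI) (auto simp: pack_def dest!: quadruple_index)

lemma pack_eq_zero_iff:
  assumes "degree r > 0"
  shows "pack r P0 P1 P2 P3 = 0\<^sub>v (4 * degree r) \<longleftrightarrow> r dvd P0 \<and> r dvd P1 \<and> r dvd P2 \<and> r dvd P3"
proof
  assume "pack r P0 P1 P2 P3 = 0\<^sub>v (4 * degree r)"
  then have "([P0, P1, P2, P3] ! i) mod r = 0" if "i < 4" for i
    using blk_pack[OF assms that, of P0 P1 P2 P3] block_index[OF that, of _ "degree r"]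
    by (intro poly_eqI) (metis coeff_0 coeff_blk index_zero_vec(1))
  from this[of 0] this[of 1] this[of 2] this[of 3]
  show "r dvd P0 \<and> r dvd P1 \<and> r dvd P2 \<and> r dvd P3" by (simp add: mod_eq_0_iff_dvd)
next
  assume "r dvd P0 \<and> r dvd P1 \<and> r dvd P2 \<and> r dvd P3"
  then show "pack r P0 P1 P2 P3 = 0\<^sub>v (4 * degree r)"
    by (intro eq_vecI) (auto simp: pack_def dest!: quadruple_index)
qed

section \<open>Endomorphisms of coordinate spaces and polynomials in them\<close>

lemma endomorphism_module_vecI:
  assumes "\<And>x. x \<in> carrier_vec n \<Longrightarrow> f x \<in> carrier_vec n"
    and "\<And>x y. x \<in> carrier_vec n \<Longrightarrow> y \<in> carrier_vec n \<Longrightarrow> f (x + y) = f x + f y"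
    and "\<And>c x. x \<in> carrier_vec n \<Longrightarrow> f (c \<cdot>\<^sub>v x) = c \<cdot>\<^sub>v f x"
  shows "endomorphism (module_vec TYPE('a::field) n) f"
  unfolding endomorphism_def linear_map_def mod_hom_def mod_hom_axioms_def
    LinearCombinations.module_hom_def
  using assms by (auto simp: vec_vs vec_module module_vec_simps)

lemma poly_end_module_vec:
  assumes f: "\<And>x. x \<in> carrier_vec n \<Longrightarrow> f x \<in> carrier_vec n" and x: "x \<in> carrier_vec n"
  shows "poly_end (module_vec TYPE('a::field) n) g f x
    = vec n (\<lambda>k. \<Sum>i\<le>degree g. coeff g i * ((f ^^ i) x) $ k)"
proof -
  have it: "(f ^^ i) x \<in> carrier_vec n" for i
    by (induction i) (auto simp: f x)
  interpret vec_space "TYPE('a)" n .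
  show ?thesis
    unfolding poly_end_def finsum_vec[symmetric]
    using it
    by (intro eq_vecI) (auto simp: index_finsum_vec module_vec_simps carrier_vecD[OF it] simp del: finsum_vec
        intro!: sum.cong carrier_vecD[OF finsum_vec_closed])
qed

lemma poly_end_0:
  assumes "\<And>x. x \<in> carrier_vec n \<Longrightarrow> f x \<in> carrier_vec n" "x \<in> carrier_vec n"
  shows "poly_end (module_vec TYPE('a::field) n) 0 f x = 0\<^sub>v n"
  using poly_end_module_vec[where g = 0, OF assms] by auto

lemma poly_end_pCons:
  assumes f: "\<And>x. x \<in> carrier_vec n \<Longrightarrow> f x \<in> carrier_vec n" and x: "x \<in> carrier_vec n"
  shows "poly_end (module_vec TYPE('a::field) n) (pCons c g) f x
    = c \<cdot>\<^sub>v x + poly_end (module_vec TYPE('a) n) g f (f x)"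
proof -
  \<comment> \<open>The case \<open>g = 0\<close> is apart because \<open>pCons c 0\<close> has
    degree \<open>0\<close> rather than \<open>Suc (degree g)\<close>.\<close>
  have "(\<Sum>i\<le>degree (pCons c g). coeff (pCons c g) i * ((f ^^ i) x) $ k)
      = c * x $ k + (\<Sum>i\<le>degree g. coeff g i * ((f ^^ i) (f x)) $ k)" for k
    by (cases "g = 0") (simp_all add: sum.atMost_Suc_shift funpow_swap1 del: sum.atMost_Suc)
  then show ?thesis
    using x by (intro eq_vecI) (auto simp: poly_end_module_vec f)
qed

lemma poly_end_quadratic:
  assumes f: "\<And>x. x \<in> carrier_vec n \<Longrightarrow> f x \<in> carrier_vec n" and x: "x \<in> carrier_vec n"
  shows "poly_end (module_vec TYPE('a::field) n) [:c0, c1, 1:] f x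
    = c0 \<cdot>\<^sub>v x + (c1 \<cdot>\<^sub>v f x + f (f x))"
  using assms by (simp add: poly_end_pCons poly_end_0)

lemma finsum_two_module_vec:
  assumes "g 0 \<in> carrier_vec n" "g 1 \<in> carrier_vec n"
  shows "(\<Oplus>\<^bsub>module_vec TYPE('a::field) n\<^esub>i\<in>{..<2::nat}. g i) = g 0 + g 1"
proof -
  interpret vec_space "TYPE('a)" n .
  have "{..<2::nat} = {0, 1}" by auto
  then show ?thesis
    using assms unfolding finsum_vec[symmetric]
    by (auto simp: finsum_vec_insert finsum_vec_empty simp del: finsum_vec)
qed

section \<open>The quaternion algebra\<close>

text \<open>The maps below are the left multiplications by \<open>u\<close>, \<open>a\<close> and \<open>b\<close> in the basis
  \<open>1, u, a, ua\<close>. Here \<open>a\<^sup>2 = l a - al\<close> and \<open>b\<^sup>2 = (l - de) b - be\<close>, so that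
  \<open>u\<^sup>2 = z + de u\<close> and \<open>a u = (z + be - al) + l u + de a - u a\<close>.\<close>

definition quat_u :: "'a::field poly \<Rightarrow> 'a poly \<Rightarrow> 'a poly \<Rightarrow> 'a vec \<Rightarrow> 'a vec" where
  "quat_u r z de x = pack r
     (z * blk r x 1)
     (blk r x 0 + de * blk r x 1)
     (z * blk r x 3)
     (blk r x 2 + de * blk r x 3)"

definition quat_a ::
  "'a::field poly \<Rightarrow> 'a poly \<Rightarrow> 'a poly \<Rightarrow> 'a poly \<Rightarrow> 'a poly \<Rightarrow> 'a poly \<Rightarrow> 'a vec \<Rightarrow> 'a vec" where
  "quat_a r z de l al be x = pack r
     ((z + be - al) * blk r x 1 - al * blk r x 2 - al * de * blk r x 3)
     (l * blk r x 1 + al * blk r x 3)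
     (blk r x 0 + de * blk r x 1 + l * blk r x 2 + (z + be - al + de * l) * blk r x 3)
     (- blk r x 1)"

definition quat_b ::
  "'a::field poly \<Rightarrow> 'a poly \<Rightarrow> 'a poly \<Rightarrow> 'a poly \<Rightarrow> 'a poly \<Rightarrow> 'a poly \<Rightarrow> 'a vec \<Rightarrow> 'a vec" where
  "quat_b r z de l al be x = quat_a r z de l al be x - quat_u r z de x"

text \<open>The polynomial inside is the coefficient of \<open>x\<^sup>* y\<close> on \<open>ua\<close>; taking the coefficient on
  \<open>z\<^bsup>deg r - 1\<^esup>\<close> is the linear functional on \<open>F[z]/(r)\<close>.\<close>

definition quat_form :: "'a::field poly \<Rightarrow> 'a poly \<Rightarrow> 'a vec \<Rightarrow> 'a vec \<Rightarrow> 'a" where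
  "quat_form r de x y = coeff
     ((blk r x 0 * blk r y 3 - blk r x 3 * blk r y 0 + blk r x 1 * blk r y 2 - blk r x 2 * blk r y 1
       + de * (blk r x 1 * blk r y 3 - blk r x 3 * blk r y 1)) mod r)
     (degree r - 1)"

lemma quat_u_pack:
  assumes "degree r > 0"
  shows "quat_u r z de (pack r P0 P1 P2 P3) = pack r (z * P1) (P0 + de * P1) (z * P3) (P2 + de * P3)"
  unfolding quat_u_def blk_pack_simps[OF assms] by (intro pack_cong mod_cong_intros)

lemma quat_a_pack:
  assumes "degree r > 0"
  shows "quat_a r z de l al be (pack r P0 P1 P2 P3) = pack r
     ((z + be - al) * P1 - al * P2 - al * de * P3)
     (l * P1 + al * P3)
     (P0 + de * P1 + l * P2 + (z + be - al + de * l) * P3)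
     (- P1)"
  unfolding quat_a_def blk_pack_simps[OF assms] by (intro pack_cong mod_cong_intros)

lemma quat_b_pack:
  assumes "degree r > 0"
  shows "quat_b r z de l al be (pack r P0 P1 P2 P3) = pack r
     ((be - al) * P1 - al * P2 - al * de * P3)
     ((l - de) * P1 + al * P3 - P0)
     (P0 + de * P1 + l * P2 + (be - al + de * l) * P3)
     (- P1 - P2 - de * P3)"
  unfolding quat_b_def quat_a_pack[OF assms] quat_u_pack[OF assms] pack_diff
  by (simp add: algebra_simps)

lemma quat_form_pack:
  assumes "degree r > 0"
  shows "quat_form r de (pack r P0 P1 P2 P3) (pack r Q0 Q1 Q2 Q3) = coeff
    ((P0 * Q3 - P3 * Q0 + P1 * Q2 - P2 * Q1 + de * (P1 * Q3 - P3 * Q1)) mod r) (degree r - 1)"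
  unfolding quat_form_def blk_pack_simps[OF assms]
  by (intro arg_cong[where f = "\<lambda>P. coeff P (degree r - 1)"] mod_cong_intros)

lemma endomorphism_quat_u:
  assumes "degree r > 0"
  shows "endomorphism (module_vec TYPE('a::field) (4 * degree r)) (quat_u r z de)"
proof (rule endomorphism_module_vecI)
  fix x y :: "'a vec" and c
  assume "x \<in> carrier_vec (4 * degree r)"
  then obtain P0 P1 P2 P3 where x: "x = pack r P0 P1 P2 P3" by (rule pack_cases)
  show "quat_u r z de x \<in> carrier_vec (4 * degree r)"
    by (simp add: x quat_u_pack assms)
  show "quat_u r z de (c \<cdot>\<^sub>v x) = c \<cdot>\<^sub>v quat_u r z de x"
    unfolding x pack_smult quat_u_pack[OF assms] by (simp add: algebra_simps smult_add_right)
  assume "y \<in> carrier_vec (4 * degree r)"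
  then obtain Q0 Q1 Q2 Q3 where y: "y = pack r Q0 Q1 Q2 Q3" by (rule pack_cases)
  show "quat_u r z de (x + y) = quat_u r z de x + quat_u r z de y"
    unfolding x y pack_add quat_u_pack[OF assms] by (simp add: algebra_simps)
qed

lemma endomorphism_quat_a:
  assumes "degree r > 0"
  shows "endomorphism (module_vec TYPE('a::field) (4 * degree r)) (quat_a r z de l al be)"
proof (rule endomorphism_module_vecI)
  fix x y :: "'a vec" and c
  assume "x \<in> carrier_vec (4 * degree r)"
  then obtain P0 P1 P2 P3 where x: "x = pack r P0 P1 P2 P3" by (rule pack_cases)
  show "quat_a r z de l al be x \<in> carrier_vec (4 * degree r)"
    by (simp add: x quat_a_pack assms)
  show "quat_a r z de l al be (c \<cdot>\<^sub>v x) = c \<cdot>\<^sub>v quat_a r z de l al be x"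
    unfolding x pack_smult quat_a_pack[OF assms]
    by (simp add: algebra_simps smult_add_right smult_diff_right)
  assume "y \<in> carrier_vec (4 * degree r)"
  then obtain Q0 Q1 Q2 Q3 where y: "y = pack r Q0 Q1 Q2 Q3" by (rule pack_cases)
  show "quat_a r z de l al be (x + y) = quat_a r z de l al be x + quat_a r z de l al be y"
    unfolding x y pack_add quat_a_pack[OF assms] by (simp add: algebra_simps)
qed

lemma endomorphism_quat_b:
  assumes "degree r > 0"
  shows "endomorphism (module_vec TYPE('a::field) (4 * degree r)) (quat_b r z de l al be)"
proof (rule endomorphism_module_vecI)
  fix x y :: "'a vec" and c
  assume "x \<in> carrier_vec (4 * degree r)"
  then obtain P0 P1 P2 P3 where x: "x = pack r P0 P1 P2 P3" by (rule pack_cases)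
  show "quat_b r z de l al be x \<in> carrier_vec (4 * degree r)"
    by (simp add: x quat_b_pack assms)
  show "quat_b r z de l al be (c \<cdot>\<^sub>v x) = c \<cdot>\<^sub>v quat_b r z de l al be x"
    unfolding x pack_smult quat_b_pack[OF assms]
    by (simp add: algebra_simps smult_add_right smult_diff_right)
  assume "y \<in> carrier_vec (4 * degree r)"
  then obtain Q0 Q1 Q2 Q3 where y: "y = pack r Q0 Q1 Q2 Q3" by (rule pack_cases)
  show "quat_b r z de l al be (x + y) = quat_b r z de l al be x + quat_b r z de l al be y"
    unfolding x y pack_add quat_b_pack[OF assms] by (simp add: algebra_simps)
qed

text \<open>The relation holds already for the unreduced quadruples: every coordinate cancels to
  \<open>0\<close>, so divisibility by \<open>r\<close> is trivial.\<close>

lemma quat_a_root: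
  assumes "degree r > 0" "al = [:a0:]" "l = [:a1:]" "x \<in> carrier_vec (4 * degree r)"
  shows "a0 \<cdot>\<^sub>v x + ((- a1) \<cdot>\<^sub>v quat_a r z de l al be x
    + quat_a r z de l al be (quat_a r z de l al be x)) = 0\<^sub>v (4 * degree r)"
proof -
  obtain P0 P1 P2 P3 where x: "x = pack r P0 P1 P2 P3" using assms(4) by (rule pack_cases)
  have c: "[:a0:] = al" "[:- a1:] = - l" using assms by simp_all
  show ?thesis
    unfolding x quat_a_pack[OF assms(1)] pack_smult pack_add c pack_eq_zero_iff[OF assms(1)]
    by (simp add: algebra_simps)
qed

text \<open>The same cancellation as for \<open>a\<close>. The trace of \<open>b\<close> is
  \<open>l - de\<close>, which becomes tr p - \<delta> = tr q in the application.\<close>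

lemma quat_b_root:
  assumes "degree r > 0" "be = [:b0:]" "l - de = [:b1:]" "x \<in> carrier_vec (4 * degree r)"
  shows "b0 \<cdot>\<^sub>v x + ((- b1) \<cdot>\<^sub>v quat_b r z de l al be x
    + quat_b r z de l al be (quat_b r z de l al be x)) = 0\<^sub>v (4 * degree r)"
proof -
  obtain P0 P1 P2 P3 where x: "x = pack r P0 P1 P2 P3" using assms(4) by (rule pack_cases)
  have c: "[:b0:] = be" "[:- b1:] = - (l - de)" using assms by simp_all
  show ?thesis
    unfolding x quat_b_pack[OF assms(1)] pack_smult pack_add c pack_eq_zero_iff[OF assms(1)]
    by (simp add: algebra_simps)
qed

section \<open>The symplectic form and its alternating endomorphisms\<close>

lemma top_coeff_mod_nondegenerate:
  assumes "degree r > 0" "\<And>g. coeff ((f * g) mod r) (degree r - 1) = 0"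
  shows "r dvd f"
proof (rule ccontr)
  assume "\<not> r dvd f"
  define h where "h = f mod r"
  have "r \<noteq> 0" using assms(1) by auto
  then have h: "h \<noteq> 0" "degree h < degree r"
    using \<open>\<not> r dvd f\<close> assms(1) degree_mod_less[of r f] by (auto simp: h_def mod_eq_0_iff_dvd)
  \<comment> \<open>This shift moves the leading term of \<open>h\<close> to degree
    \<open>degree r - 1\<close>, the highest one that survives without reduction, so the functional
    reads off the leading coefficient of \<open>h\<close>.\<close>
  define g :: "'a poly" where "g = monom 1 (degree r - 1 - degree h)"
  have g: "g \<noteq> 0" and hg: "degree (h * g) = degree r - 1"
    using h by (simp_all add: g_def degree_mult_eq degree_monom_eq monom_eq_0_iff)
  have "coeff (h * g) (degree (h * g)) \<noteq> 0"
    using h g by (simp only: leading_coeff_0_iff mult_eq_0_iff simp_thms)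
  then have "coeff (h * g) (degree r - 1) \<noteq> 0" unfolding hg .
  moreover have "(h * g) mod r = h * g"
    using assms(1) hg by (simp add: mod_poly_less)
  moreover have "(h * g) mod r = (f * g) mod r"
    by (simp add: h_def mod_simps)
  ultimately show False using assms(2)[of g] by simp
qed

lemma symplectic_form_quat_form:
  assumes "degree r > 0"
  shows "symplectic_form (module_vec TYPE('a::field) (4 * degree r)) (quat_form r de)"
proof -
  let ?n = "4 * degree r"
  have bil: "quat_form r de (x + y) w = quat_form r de x w + quat_form r de y w"
    "quat_form r de w (x + y) = quat_form r de w x + quat_form r de w y"
    "quat_form r de (c \<cdot>\<^sub>v x) w = c * quat_form r de x w"
    "quat_form r de w (c \<cdot>\<^sub>v x) = c * quat_form r de w x"
    if xyw: "x \<in> carrier_vec ?n" "y \<in> carrier_vec ?n" "w \<in> carrier_vec ?n" for x y w :: "'a vec" and c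
  proof -
    obtain P0 P1 P2 P3 where x: "x = pack r P0 P1 P2 P3" using xyw(1) by (rule pack_cases)
    obtain Q0 Q1 Q2 Q3 where y: "y = pack r Q0 Q1 Q2 Q3" using xyw(2) by (rule pack_cases)
    obtain R0 R1 R2 R3 where w: "w = pack r R0 R1 R2 R3" using xyw(3) by (rule pack_cases)
    \<comment> \<open>The reversed rules gather each side into one coefficient of one remainder,
      leaving a polynomial identity.\<close>
    note expand = x y w pack_add pack_smult quat_form_pack[OF assms]
      coeff_add[symmetric] coeff_smult[symmetric] poly_mod_add_left[symmetric] mod_smult_left[symmetric]
    show "quat_form r de (x + y) w = quat_form r de x w + quat_form r de y w"
      "quat_form r de w (x + y) = quat_form r de w x + quat_form r de w y"
      unfolding expand by (simp_all add: algebra_simps)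
    show "quat_form r de (c \<cdot>\<^sub>v x) w = c * quat_form r de x w"
      "quat_form r de w (c \<cdot>\<^sub>v x) = c * quat_form r de w x"
      unfolding expand by (simp_all add: algebra_simps smult_add_right smult_diff_right)
  qed
  \<comment> \<open>The products cancel in pairs of opposite sign, without division by 2.\<close>
  have alt: "quat_form r de x x = 0" if x: "x \<in> carrier_vec ?n" for x :: "'a vec"
  proof -
    obtain P0 P1 P2 P3 where "x = pack r P0 P1 P2 P3" using x by (rule pack_cases)
    then show ?thesis using assms by (simp add: quat_form_pack algebra_simps)
  qed
  have nondeg: "x = 0\<^sub>v ?n"
    if x: "x \<in> carrier_vec ?n" and 0: "\<forall>y\<in>carrier_vec ?n. quat_form r de x y = 0" for x :: "'a vec"
  proof -
    obtain P0 P1 P2 P3 where P: "x = pack r P0 P1 P2 P3" using x by (rule pack_cases)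
    have zero: "coeff ((P0 * Q3 - P3 * Q0 + P1 * Q2 - P2 * Q1 + de * (P1 * Q3 - P3 * Q1)) mod r)
        (degree r - 1) = 0" for Q0 Q1 Q2 Q3
      using 0 quat_form_pack[OF assms, of de P0 P1 P2 P3 Q0 Q1 Q2 Q3] unfolding P by simp
    \<comment> \<open>Each test vector has a single nonzero coordinate. The positions in
      \<open>zero[of ...]\<close> follow the order of occurrence \<open>Q3\<close>,
      \<open>Q0\<close>, \<open>Q2\<close>, \<open>Q1\<close>. The four resulting divisibilities
      form a triangular system.\<close>
    have "r dvd P3"
      using zero[of 0 "- g" 0 0 for g] by (intro top_coeff_mod_nondegenerate[OF assms]) simp
    moreover have "r dvd P1"
      using zero[of 0 0 g 0 for g] by (intro top_coeff_mod_nondegenerate[OF assms]) simp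
    moreover have "r dvd - P2 - de * P3"
      using zero[of 0 0 0 g for g]
      by (intro top_coeff_mod_nondegenerate[OF assms]) (simp add: algebra_simps)
    moreover have "r dvd P0 + de * P1"
      using zero[of g 0 0 0 for g]
      by (intro top_coeff_mod_nondegenerate[OF assms]) (simp add: algebra_simps)
    ultimately show ?thesis
      unfolding P pack_eq_zero_iff[OF assms]
      by (simp add: dvd_add_left_iff dvd_diff_left_iff)
  qed
  show ?thesis
    unfolding symplectic_form_def bilinear_form_def module_vec_simps
    using bil alt nondeg by simp
qed

text \<open>Self-adjointness would only show that twice the value is zero. In coordinates the
  polynomial under \<open>mod r\<close> cancels identically, which covers characteristic 2 as
  well.\<close>

lemma quat_form_self_maps:
  assumes "degree r > 0" "x \<in> carrier_vec (4 * degree r)"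
  shows "quat_form r de x (quat_u r z de x) = 0"
    and "quat_form r de x (quat_a r z de l al be x) = 0"
    and "quat_form r de x (quat_b r z de l al be x) = 0"
proof -
  obtain P0 P1 P2 P3 where x: "x = pack r P0 P1 P2 P3" using assms(2) by (rule pack_cases)
  show "quat_form r de x (quat_u r z de x) = 0"
    and "quat_form r de x (quat_a r z de l al be x) = 0"
    and "quat_form r de x (quat_b r z de l al be x) = 0"
    unfolding x quat_u_pack[OF assms(1)] quat_a_pack[OF assms(1)] quat_b_pack[OF assms(1)]
      quat_form_pack[OF assms(1)]
    by (simp_all add: algebra_simps)
qed

section \<open>Invariant factors\<close>

text \<open>Since \<open>z = u\<^sup>2 - \<delta> u\<close>, writing \<open>f = f0(t\<^sup>2 - \<delta> t) + t f1(t\<^sup>2 - \<delta> t)\<close> gives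
  \<open>f(u) = f0(z) + f1(z) u\<close>.\<close>

lemma poly_end_quat_u:
  assumes "degree r > 0"
  shows "\<exists>f0 f1. f = pcompose f0 [:0, - \<delta>, 1:] + [:0, 1:] * pcompose f1 [:0, - \<delta>, 1:] \<and>
    (\<forall>P0 P1 P2 P3.
      poly_end (module_vec TYPE('a::field) (4 * degree r)) f (quat_u r [:0, 1:] [:\<delta>:]) (pack r P0 P1 P2 P3)
      = pack r (f0 * P0 + f1 * ([:0, 1:] * P1)) (f1 * P0 + (f0 + [:\<delta>:] * f1) * P1)
               (f0 * P2 + f1 * ([:0, 1:] * P3)) (f1 * P2 + (f0 + [:\<delta>:] * f1) * P3))"
proof (induction f)
  case 0
  have "pack r 0 0 0 0 = 0\<^sub>v (4 * degree r)"
    using pack_eq_zero_iff[OF assms, of 0 0 0 0] by simp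
  then show ?case
    by (intro exI[of _ 0]) (simp add: poly_end_0 quat_u_def)
next
  case (pCons c f)
  \<comment> \<open>Named constants prevent simp from rewriting \<open>[:0, 1:] * P\<close> to
    \<open>pCons 0 P\<close>, which would obstruct ring normalisation.\<close>
  define t :: "'a poly" where "t = [:0, 1:]"
  define d where "d = [:\<delta>:]"
  define w where "w = [:0, - \<delta>, 1:]"
  have w: "w = t * t - d * t" by (simp add: w_def t_def d_def)
  \<comment> \<open>The square of \<open>t\<close> is replaced by \<open>w + d * t\<close>. This
    gives the new pair \<open>[:c:] + t * f1\<close> and \<open>f0 + d * f1\<close>, where
    \<open>t\<close> plays the role of \<open>z\<close> and \<open>pcompose\<close> sends it to
    \<open>w\<close>.\<close>
  have split: "[:c:] + t * (F0 + t * F1) = [:c:] + w * F1 + t * (F0 + d * F1)" for F0 F1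
    unfolding w by (simp only: algebra_simps)
  obtain f0 f1 where f: "f = pcompose f0 w + t * pcompose f1 w"
    and act: "poly_end (module_vec TYPE('a) (4 * degree r)) f (quat_u r t d) (pack r P0 P1 P2 P3)
      = pack r (f0 * P0 + f1 * (t * P1)) (f1 * P0 + (f0 + d * f1) * P1)
               (f0 * P2 + f1 * (t * P3)) (f1 * P2 + (f0 + d * f1) * P3)" for P0 P1 P2 P3
    using pCons.IH unfolding t_def d_def w_def by blast
  have cf: "pCons c f = [:c:] + t * f" by (simp add: t_def)
  have "pcompose t w = w" "pcompose d w = d" "pcompose [:c:] w = [:c:]"
    by (simp_all add: t_def d_def pcompose_pCons)
  then have "pCons c f = pcompose ([:c:] + t * f1) w + t * pcompose (f0 + d * f1) w"
    unfolding cf unfolding f pcompose_add pcompose_mult by (simp only: split)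
  moreover have "poly_end (module_vec TYPE('a) (4 * degree r)) (pCons c f) (quat_u r t d) (pack r P0 P1 P2 P3)
      = pack r (([:c:] + t * f1) * P0 + (f0 + d * f1) * (t * P1))
               ((f0 + d * f1) * P0 + (([:c:] + t * f1) + d * (f0 + d * f1)) * P1)
               (([:c:] + t * f1) * P2 + (f0 + d * f1) * (t * P3))
               ((f0 + d * f1) * P2 + (([:c:] + t * f1) + d * (f0 + d * f1)) * P3)" for P0 P1 P2 P3
  proof -
    have "poly_end (module_vec TYPE('a) (4 * degree r)) (pCons c f) (quat_u r t d) (pack r P0 P1 P2 P3)
      = c \<cdot>\<^sub>v pack r P0 P1 P2 P3
        + poly_end (module_vec TYPE('a) (4 * degree r)) f (quat_u r t d) (quat_u r t d (pack r P0 P1 P2 P3))"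
      by (intro poly_end_pCons) (simp_all add: quat_u_def)
    also have "\<dots> = pack r ([:c:] * P0 + (f0 * (t * P1) + f1 * (t * (P0 + d * P1))))
      ([:c:] * P1 + (f1 * (t * P1) + (f0 + d * f1) * (P0 + d * P1)))
      ([:c:] * P2 + (f0 * (t * P3) + f1 * (t * (P2 + d * P3))))
      ([:c:] * P3 + (f1 * (t * P3) + (f0 + d * f1) * (P2 + d * P3)))"
      unfolding quat_u_pack[OF assms] act pack_smult pack_add ..
    finally show ?thesis by (simp add: algebra_simps)
  qed
  ultimately show ?case unfolding t_def d_def w_def by blast
qed

text \<open>Parity of degrees: composition with \<open>w\<close> yields even degrees, and the factor
  \<open>t\<close> makes the second term odd, so nonzero terms cannot cancel. Hence the splitting of
  a polynomial is unique.\<close>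

lemma pcompose_split_eq_0:
  fixes f0 f1 w :: "'a::field poly"
  assumes "degree w = 2" "pcompose f0 w + [:0, 1:] * pcompose f1 w = 0"
  shows "f0 = 0 \<and> f1 = 0"
proof -
  have "f1 = 0"
  proof (rule ccontr)
    assume "f1 \<noteq> 0"
    then have "pcompose f1 w \<noteq> 0" using assms(1) by (simp add: pcompose_eq_0_iff)
    then have "degree ([:0, 1:] * pcompose f1 w) = 1 + 2 * degree f1"
      using assms(1) by (simp add: degree_mult_eq degree_pcompose)
    moreover have "pcompose f0 w = - ([:0, 1:] * pcompose f1 w)"
      using assms(2) by (simp only: eq_neg_iff_add_eq_0)
    then have "degree ([:0, 1:] * pcompose f1 w) = 2 * degree f0"
      by (metis assms(1) degree_minus degree_pcompose mult.commute)
    ultimately show False by presburger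
  qed
  then show ?thesis using assms by (simp add: pcompose_eq_0_iff)
qed

text \<open>With \<open>w\<close> the inner quadratic, \<open>F[t]\<close> is free over
  \<open>F[w]\<close> with basis \<open>1, t\<close>, so divisibility by an element of
  \<open>F[w]\<close> is tested on coordinates.\<close>

lemma pcompose_dvd_split_iff:
  fixes f0 f1 r :: "'a::field poly"
  assumes "degree r > 0"
  shows "pcompose r [:0, - \<delta>, 1:] dvd pcompose f0 [:0, - \<delta>, 1:] + [:0, 1:] * pcompose f1 [:0, - \<delta>, 1:]
    \<longleftrightarrow> r dvd f0 \<and> r dvd f1"
    (is "pcompose r ?w dvd _ \<longleftrightarrow> _")
proof
  assume "pcompose r ?w dvd pcompose f0 ?w + [:0, 1:] * pcompose f1 ?w"
  then obtain h where h: "pcompose f0 ?w + [:0, 1:] * pcompose f1 ?w = pcompose r ?w * h" ..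
  \<comment> \<open>Only the existence of a splitting of \<open>h\<close> is taken from
    \<open>poly_end_quat_u\<close> here.\<close>
  obtain h0 h1 where h': "h = pcompose h0 ?w + [:0, 1:] * pcompose h1 ?w"
    using poly_end_quat_u[OF assms, of h \<delta>] by blast
  then have "pcompose (f0 - r * h0) ?w + [:0, 1:] * pcompose (f1 - r * h1) ?w = 0"
    using h unfolding pcompose_diff pcompose_mult h' by (simp only: algebra_simps) simp
  from pcompose_split_eq_0[OF _ this] show "r dvd f0 \<and> r dvd f1" by simp
next
  assume "r dvd f0 \<and> r dvd f1"
  then show "pcompose r ?w dvd pcompose f0 ?w + [:0, 1:] * pcompose f1 ?w"
    by (auto simp: pcompose_mult simp del: mult_pCons_left elim!: dvdE intro!: dvd_add dvd_mult)
qed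

lemma invariant_factors_quat_u:
  assumes "degree r > 0" "lead_coeff r = 1"
  shows "invariant_factors (module_vec TYPE('a::field) (4 * degree r)) (quat_u r [:0, 1:] [:\<delta>:])
    [pcompose r [:0, - \<delta>, 1:], pcompose r [:0, - \<delta>, 1:]]"
proof -
  let ?V = "module_vec TYPE('a) (4 * degree r)" and ?u = "quat_u r [:0, 1:] [:\<delta>:]"
  let ?w = "[:0, - \<delta>, 1:]"
  \<comment> \<open>The classes of \<open>1\<close> and \<open>a\<close>. If \<open>f\<close> splits
    into \<open>f0, f1\<close>, then \<open>f(u)\<close> sends them to \<open>(f0, f1, 0, 0)\<close>
    and \<open>(0, 0, f0, f1)\<close>, so the two summands fill separate blocks.\<close>
  define e where "e i = (if i = 0 then pack r 1 0 0 0 else pack r 0 0 1 0)" for i :: nat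
  have comb: "(\<Oplus>\<^bsub>?V\<^esub>i\<in>{..<2}. poly_end ?V (f i) ?u (e i)) = pack r a0 a1 b0 b1"
    if "\<And>P0 P1 P2 P3. poly_end ?V (f 0) ?u (pack r P0 P1 P2 P3)
        = pack r (a0 * P0 + a1 * ([:0, 1:] * P1)) (a1 * P0 + (a0 + [:\<delta>:] * a1) * P1)
                 (a0 * P2 + a1 * ([:0, 1:] * P3)) (a1 * P2 + (a0 + [:\<delta>:] * a1) * P3)"
      "\<And>P0 P1 P2 P3. poly_end ?V (f 1) ?u (pack r P0 P1 P2 P3)
        = pack r (b0 * P0 + b1 * ([:0, 1:] * P1)) (b1 * P0 + (b0 + [:\<delta>:] * b1) * P1)
                 (b0 * P2 + b1 * ([:0, 1:] * P3)) (b1 * P2 + (b0 + [:\<delta>:] * b1) * P3)"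
    for f a0 a1 b0 b1
    using that by (subst finsum_two_module_vec) (simp_all add: e_def pack_add)
  \<comment> \<open>\<open>poly_end_quat_u\<close> provides the action for some splitting;
    uniqueness identifies it with the prescribed \<open>f0, f1\<close>.\<close>
  have act: "poly_end ?V (pcompose f0 ?w + [:0, 1:] * pcompose f1 ?w) ?u (pack r P0 P1 P2 P3)
      = pack r (f0 * P0 + f1 * ([:0, 1:] * P1)) (f1 * P0 + (f0 + [:\<delta>:] * f1) * P1)
               (f0 * P2 + f1 * ([:0, 1:] * P3)) (f1 * P2 + (f0 + [:\<delta>:] * f1) * P3)"
    for f0 f1 P0 P1 P2 P3
  proof -
    let ?f = "pcompose f0 ?w + [:0, 1:] * pcompose f1 ?w"
    obtain a0 a1 where a: "?f = pcompose a0 ?w + [:0, 1:] * pcompose a1 ?w"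
      "\<And>P0 P1 P2 P3. poly_end ?V ?f ?u (pack r P0 P1 P2 P3)
        = pack r (a0 * P0 + a1 * ([:0, 1:] * P1)) (a1 * P0 + (a0 + [:\<delta>:] * a1) * P1)
                 (a0 * P2 + a1 * ([:0, 1:] * P3)) (a1 * P2 + (a0 + [:\<delta>:] * a1) * P3)"
      using poly_end_quat_u[OF assms(1), of ?f \<delta>] by blast
    have "pcompose (f0 - a0) ?w + [:0, 1:] * pcompose (f1 - a1) ?w = 0"
      using a(1) unfolding pcompose_diff by (simp only: algebra_simps) simp
    from pcompose_split_eq_0[OF _ this] have "f0 = a0 \<and> f1 = a1" by simp
    then show ?thesis using a(2) by simp
  qed
  have gen: "\<exists>f. v = (\<Oplus>\<^bsub>?V\<^esub>i\<in>{..<2}. poly_end ?V (f i) ?u (e i))"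
    if v: "v \<in> carrier_vec (4 * degree r)" for v
  proof -
    obtain P0 P1 P2 P3 where P: "v = pack r P0 P1 P2 P3" using v by (rule pack_cases)
    define f where "f i = (if i = 0 then pcompose P0 ?w + [:0, 1:] * pcompose P1 ?w
      else pcompose P2 ?w + [:0, 1:] * pcompose P3 ?w)" for i :: nat
    have "(\<Oplus>\<^bsub>?V\<^esub>i\<in>{..<2}. poly_end ?V (f i) ?u (e i)) = pack r P0 P1 P2 P3"
      by (intro comb) (simp_all only: f_def if_True if_False one_neq_zero refl act)
    then show ?thesis using P by metis
  qed
  have ker: "(\<Oplus>\<^bsub>?V\<^esub>i\<in>{..<2}. poly_end ?V (f i) ?u (e i)) = 0\<^sub>v (4 * degree r)
      \<longleftrightarrow> pcompose r ?w dvd f 0 \<and> pcompose r ?w dvd f 1" for f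
  proof -
    obtain a0 a1 where a: "f 0 = pcompose a0 ?w + [:0, 1:] * pcompose a1 ?w"
      "\<And>P0 P1 P2 P3. poly_end ?V (f 0) ?u (pack r P0 P1 P2 P3)
        = pack r (a0 * P0 + a1 * ([:0, 1:] * P1)) (a1 * P0 + (a0 + [:\<delta>:] * a1) * P1)
                 (a0 * P2 + a1 * ([:0, 1:] * P3)) (a1 * P2 + (a0 + [:\<delta>:] * a1) * P3)"
      using poly_end_quat_u[OF assms(1), of "f 0" \<delta>] by blast
    obtain b0 b1 where b: "f 1 = pcompose b0 ?w + [:0, 1:] * pcompose b1 ?w"
      "\<And>P0 P1 P2 P3. poly_end ?V (f 1) ?u (pack r P0 P1 P2 P3)
        = pack r (b0 * P0 + b1 * ([:0, 1:] * P1)) (b1 * P0 + (b0 + [:\<delta>:] * b1) * P1)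
                 (b0 * P2 + b1 * ([:0, 1:] * P3)) (b1 * P2 + (b0 + [:\<delta>:] * b1) * P3)"
      using poly_end_quat_u[OF assms(1), of "f 1" \<delta>] by blast
    show ?thesis
      unfolding comb[OF a(2) b(2)] pack_eq_zero_iff[OF assms(1)] a(1) b(1)
        pcompose_dvd_split_iff[OF assms(1)] by blast
  qed
  have "lead_coeff (pcompose r ?w) = 1" "degree (pcompose r ?w) > 0"
    using lead_coeff_comp[of ?w r] assms by (simp_all add: degree_pcompose)
  moreover have "e i \<in> carrier_vec (4 * degree r)" for i by (simp add: e_def)
  moreover have len: "length [pcompose r ?w, pcompose r ?w] = 2" by simp
  moreover have "(\<forall>i<2. [pcompose r ?w, pcompose r ?w] ! i dvd f i)
      \<longleftrightarrow> pcompose r ?w dvd f 0 \<and> pcompose r ?w dvd f 1" for f :: "nat \<Rightarrow> 'a poly"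
    by (auto simp: less_2_cases_iff)
  ultimately show ?thesis
    unfolding invariant_factors_def module_vec_simps len using gen ker
    by (intro conjI exI[of _ e]) simp_all
qed

section \<open>Assembly of the symplectic difference\<close>

lemma monic_quadratic_eq:
  assumes "lead_coeff p = 1" "degree p = 2"
  shows "p = [:coeff p 0, - poly_trace p, 1:]"
proof (rule poly_eqI)
  fix i
  show "coeff p i = coeff [:coeff p 0, - poly_trace p, 1:] i"
    using assms coeff_eq_0[of p i]
    by (cases "i = 0"; cases "i = 1"; cases "i = 2")
       (auto simp: poly_trace_def numeral_2_eq_2 coeff_pCons split: nat.split)
qed

theorem lemma2p2:
  fixes p q r :: "'a::field poly" and \<delta> :: 'a
  assumes "lead_coeff p = 1" and "degree p = 2"
    and "lead_coeff q = 1" and "degree q = 2"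
    and "\<delta> = poly_trace p - poly_trace q"
    and "lead_coeff r = 1" and "degree r > 0"
  shows "\<exists>(V :: ('a, 'a vec) module) b u.
    symplectic_pair V b u \<and>
    symplectic_difference p q V b u \<and>
    invariant_factors V u [pcompose r [:0, -\<delta>, 1:], pcompose r [:0, -\<delta>, 1:]]"
proof -
  let ?n = "4 * degree r"
  let ?V = "module_vec TYPE('a) ?n" and ?b = "quat_form r [:\<delta>:]"
  let ?u = "quat_u r [:0, 1:] [:\<delta>:]"
  \<comment> \<open>The trace of \<open>q\<close> is not a separate parameter: it is recovered as
    \<open>poly_trace p\<close> minus \<delta>.\<close>
  let ?u1 = "quat_a r [:0, 1:] [:\<delta>:] [:poly_trace p:] [:coeff p 0:] [:coeff q 0:]"
  let ?u2 = "quat_b r [:0, 1:] [:\<delta>:] [:poly_trace p:] [:coeff p 0:] [:coeff q 0:]"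
  interpret vec_space "TYPE('a)" ?n .
  note d = assms(7)
  have alt: "alternating_end ?V ?b ?u" "alternating_end ?V ?b ?u1" "alternating_end ?V ?b ?u2"
    unfolding alternating_end_def module_vec_simps
    by (simp_all add: d endomorphism_quat_u endomorphism_quat_a endomorphism_quat_b quat_form_self_maps)
  have pair: "symplectic_pair ?V ?b ?u"
    unfolding symplectic_pair_def
    using vec_vs fin_dim symplectic_form_quat_form[OF d] alt by blast
  have car: "?u1 x \<in> carrier_vec ?n" "?u2 x \<in> carrier_vec ?n" for x
    by (simp_all add: quat_a_def quat_b_def quat_u_def pack_diff)
  have diff: "?u x = ?u1 x \<ominus>\<^bsub>?V\<^esub> ?u2 x" if "x \<in> carrier_vec ?n" for x
  proof -
    have "?u x = ?u1 x - ?u2 x"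
      by (intro eq_vecI) (simp_all add: quat_a_def quat_b_def quat_u_def)
    also have "\<dots> = ?u1 x \<ominus>\<^bsub>?V\<^esub> ?u2 x"
      using car by (simp add: a_minus_def minus_add_uminus_vec[of _ ?n])
    finally show ?thesis .
  qed
  have "poly_end ?V p ?u1 x = 0\<^sub>v ?n" if "x \<in> carrier_vec ?n" for x
    by (subst monic_quadratic_eq[OF assms(1,2)], subst poly_end_quadratic)
      (use that car d in \<open>auto intro!: quat_a_root\<close>)
  moreover have "poly_end ?V q ?u2 x = 0\<^sub>v ?n" if "x \<in> carrier_vec ?n" for x
    by (subst monic_quadratic_eq[OF assms(3,4)], subst poly_end_quadratic)
      (use that car d assms(5) in \<open>auto intro!: quat_b_root\<close>)
  ultimately have "symplectic_difference p q ?V ?b ?u"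
    unfolding symplectic_difference_def module_vec_simps using pair alt diff by blast
  with pair invariant_factors_quat_u[OF d assms(6), of \<delta>] show ?thesis by blast
qed

end
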